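(* Let $\tau$ be a finite unary vocabulary, $t = 2^{|\tau|}$, $c_\tau := 15|\tau|2^{|\tau|}$, $\mathfrak{M}$ a $\tau$-model of size $n$, and $p \in [0,\frac{1}{t}[$. If \[ H_S(\mathfrak{M}) > ((t-1)p-1)\log(1-(t-1)p) - (t-1)p\log(p), \] then $3np - 3 < C(\mathfrak{M}) < 3n(1-(t-1)p) + c_\tau$.
   Context: All logarithms are base 2, with $0\log 0 = 0$. A $\tau$-model of size $n$ has domain $\{1,\dots,n\}$ and interprets each unary symbol as a subset. With the $t$ types $\pi_i\subseteq\tau$ and $n_i$ the number of points in exactly the relations named in $\pi_i$, $H_S(\mathfrak{M}) = \sum_i -\frac{n_i}{n}\log\frac{n_i}{n}$. $\mathrm{FO}[\tau]$-formulas are in negation normal form; size counts atomic formulas (negated or not), conjunctions, disjunctions and quantifiers, not negations. $C(\mathfrak{M})$ is the minimum size of an $\mathrm{FO}[\tau]$-sentence true in exactly those $\tau$-models of size $n$ isomorphic to $\mathfrak{M}$. *)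

theory Defs
  imports Complex_Main
begin

text \<open>A model of size \<open>n\<close> over the unary vocabulary \<open>\<tau>\<close> has domain \<open>{1..n}\<close> and is given by the
  interpretation \<open>M\<close> of its relation symbols. Values of \<open>M\<close> outside \<open>\<tau>\<close> never matter.\<close>

type_synonym 'r interp = "'r \<Rightarrow> nat set"

definition is_model :: "'r set \<Rightarrow> nat \<Rightarrow> 'r interp \<Rightarrow> bool" where
  "is_model \<tau> n M \<longleftrightarrow> (\<forall>P\<in>\<tau>. M P \<subseteq> {1..n})"

definition isomorphic :: "'r set \<Rightarrow> nat \<Rightarrow> 'r interp \<Rightarrow> 'r interp \<Rightarrow> bool" where
  "isomorphic \<tau> n M N \<longleftrightarrow>
     (\<exists>f. bij_betw f {1..n} {1..n} \<and> (\<forall>P\<in>\<tau>. \<forall>a\<in>{1..n}. a \<in> M P \<longleftrightarrow> f a \<in> N P))"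

definition type_points :: "'r set \<Rightarrow> nat \<Rightarrow> 'r interp \<Rightarrow> 'r set \<Rightarrow> nat set" where
  "type_points \<tau> n M \<pi> = {a \<in> {1..n}. \<forall>P\<in>\<tau>. a \<in> M P \<longleftrightarrow> P \<in> \<pi>}"

text \<open>The convention \<open>0 log 0 = 0\<close> holds automatically for library multiplication.\<close>

definition entropy_S :: "'r set \<Rightarrow> nat \<Rightarrow> 'r interp \<Rightarrow> real" where
  "entropy_S \<tau> n M =
     (\<Sum>\<pi>\<in>Pow \<tau>. - (real (card (type_points \<tau> n M \<pi>)) / real n)
                   * log 2 (real (card (type_points \<tau> n M \<pi>)) / real n))"

text \<open>First-order formulas with equality in negation normal form; variables are natural numbers.\<close>

datatype 'r fo =
    Rel 'r nat
  | NRel 'r nat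
  | Eq nat nat
  | NEq nat nat
  | Conj "'r fo" "'r fo"
  | Disj "'r fo" "'r fo"
  | Exi nat "'r fo"
  | Uni nat "'r fo"

fun symbols :: "'r fo \<Rightarrow> 'r set" where
  "symbols (Rel P x) = {P}"
| "symbols (NRel P x) = {P}"
| "symbols (Eq x y) = {}"
| "symbols (NEq x y) = {}"
| "symbols (Conj \<phi> \<psi>) = symbols \<phi> \<union> symbols \<psi>"
| "symbols (Disj \<phi> \<psi>) = symbols \<phi> \<union> symbols \<psi>"
| "symbols (Exi x \<phi>) = symbols \<phi>"
| "symbols (Uni x \<phi>) = symbols \<phi>"

fun free_vars :: "'r fo \<Rightarrow> nat set" where
  "free_vars (Rel P x) = {x}"
| "free_vars (NRel P x) = {x}"
| "free_vars (Eq x y) = {x, y}"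
| "free_vars (NEq x y) = {x, y}"
| "free_vars (Conj \<phi> \<psi>) = free_vars \<phi> \<union> free_vars \<psi>"
| "free_vars (Disj \<phi> \<psi>) = free_vars \<phi> \<union> free_vars \<psi>"
| "free_vars (Exi x \<phi>) = free_vars \<phi> - {x}"
| "free_vars (Uni x \<phi>) = free_vars \<phi> - {x}"

definition is_sentence :: "'r set \<Rightarrow> 'r fo \<Rightarrow> bool" where
  "is_sentence \<tau> \<phi> \<longleftrightarrow> symbols \<phi> \<subseteq> \<tau> \<and> free_vars \<phi> = {}"

text \<open>Negated atoms have size 1, since negations are not counted.\<close>

fun fo_size :: "'r fo \<Rightarrow> nat" where
  "fo_size (Rel P x) = 1"
| "fo_size (NRel P x) = 1"
| "fo_size (Eq x y) = 1"
| "fo_size (NEq x y) = 1"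
| "fo_size (Conj \<phi> \<psi>) = fo_size \<phi> + fo_size \<psi> + 1"
| "fo_size (Disj \<phi> \<psi>) = fo_size \<phi> + fo_size \<psi> + 1"
| "fo_size (Exi x \<phi>) = fo_size \<phi> + 1"
| "fo_size (Uni x \<phi>) = fo_size \<phi> + 1"

fun sat :: "nat \<Rightarrow> 'r interp \<Rightarrow> (nat \<Rightarrow> nat) \<Rightarrow> 'r fo \<Rightarrow> bool" where
  "sat n M s (Rel P x) \<longleftrightarrow> s x \<in> M P"
| "sat n M s (NRel P x) \<longleftrightarrow> s x \<notin> M P"
| "sat n M s (Eq x y) \<longleftrightarrow> s x = s y"
| "sat n M s (NEq x y) \<longleftrightarrow> s x \<noteq> s y"
| "sat n M s (Conj \<phi> \<psi>) \<longleftrightarrow> sat n M s \<phi> \<and> sat n M s \<psi>"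
| "sat n M s (Disj \<phi> \<psi>) \<longleftrightarrow> sat n M s \<phi> \<or> sat n M s \<psi>"
| "sat n M s (Exi x \<phi>) \<longleftrightarrow> (\<exists>a\<in>{1..n}. sat n M (s(x := a)) \<phi>)"
| "sat n M s (Uni x \<phi>) \<longleftrightarrow> (\<forall>a\<in>{1..n}. sat n M (s(x := a)) \<phi>)"

definition true_in :: "nat \<Rightarrow> 'r interp \<Rightarrow> 'r fo \<Rightarrow> bool" where
  "true_in n M \<phi> \<longleftrightarrow> (\<forall>s. range s \<subseteq> {1..n} \<longrightarrow> sat n M s \<phi>)"

definition describes :: "'r set \<Rightarrow> nat \<Rightarrow> 'r fo \<Rightarrow> 'r interp \<Rightarrow> bool" where
  "describes \<tau> n \<phi> M \<longleftrightarrow>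
     is_sentence \<tau> \<phi> \<and> (\<forall>N. is_model \<tau> n N \<longrightarrow> (true_in n N \<phi> \<longleftrightarrow> isomorphic \<tau> n M N))"

definition descr_complexity :: "'r set \<Rightarrow> nat \<Rightarrow> 'r interp \<Rightarrow> nat" where
  "descr_complexity \<tau> n M = (LEAST k. \<exists>\<phi>. describes \<tau> n \<phi> M \<and> fo_size \<phi> = k)"

end

theory Submission
  imports Defs
begin

text \<open>
  By Gibbs' inequality, a type occupying a fraction of at least \<open>1 - (t - 1) p\<close> of the points
  forces the entropy down to that of the distribution \<open>(1 - (t - 1) p, p, \<dots>, p)\<close>. Hence
  the largest type has fewer than \<open>n (1 - (t - 1) p)\<close> points, and a second type has more than
  \<open>n p\<close> points, since otherwise the largest one would be too large.

  Upper bound: the class sizes add up to \<open>n\<close>, so it suffices to say which types are realized and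
  that each realized type has at least the right number of points. With \<open>m\<close> the largest size,
  the latter is said by \<open>\<forall>x\<^sub>1\<dots>x\<^sub>m\<^sub>-\<^sub>1 \<forall>z \<exists>y\<close> (\<open>y\<close> has the type of \<open>z\<close> and avoids sufficiently
  many of the \<open>x\<^sub>i\<close>), where all types share the inequations.

  Lower bound: if two types have at least \<open>k + 1\<close> points, moving a point from one to the other
  must be noticed by a describing formula. Consider the graph on its quantifier occurrences whose
  edges are the equality atoms. If every component has at most \<open>k\<close> vertices, a back-and-forth
  argument that keeps a partial isomorphism separately for every component shows that the
  formula misses the change. So there are more than \<open>k\<close> quantifiers and at least \<open>k\<close> atoms.
\<close>

subsection \<open>Types and isomorphism\<close>

definition type_of :: "'r set \<Rightarrow> 'r interp \<Rightarrow> nat \<Rightarrow> 'r set" where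
  "type_of \<tau> M a = {P \<in> \<tau>. a \<in> M P}"

lemma type_of_subset: "type_of \<tau> M a \<subseteq> \<tau>"
  by (auto simp: type_of_def)

lemma mem_type_points:
  "\<pi> \<subseteq> \<tau> \<Longrightarrow> a \<in> type_points \<tau> n M \<pi> \<longleftrightarrow> a \<in> {1..n} \<and> type_of \<tau> M a = \<pi>"
  by (auto simp: type_points_def type_of_def)

lemma finite_type_points [simp]: "finite (type_points \<tau> n M \<pi>)"
  by (simp add: type_points_def)

lemma sum_card_type_points:
  assumes "finite \<tau>"
  shows "(\<Sum>\<pi>\<in>Pow \<tau>. card (type_points \<tau> n M \<pi>)) = n"
proof -
  have "(\<Sum>\<pi>\<in>Pow \<tau>. \<Sum>a\<in>{a \<in> {1..n}. type_of \<tau> M a = \<pi>}. 1) = (\<Sum>a\<in>{1..n}. 1::nat)"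
    using assms by (intro sum.group) (auto simp: type_of_def)
  moreover have "type_points \<tau> n M \<pi> = {a \<in> {1..n}. type_of \<tau> M a = \<pi>}" if "\<pi> \<in> Pow \<tau>" for \<pi>
    using that by (auto simp: mem_type_points)
  ultimately show ?thesis by simp
qed

lemma isomorphic_type_of:
  assumes "\<forall>P\<in>\<tau>. \<forall>a\<in>{1..n}. a \<in> M P \<longleftrightarrow> f a \<in> N P" "a \<in> {1..n}"
  shows "type_of \<tau> N (f a) = type_of \<tau> M a"
  using assms by (auto simp: type_of_def)

text \<open>An isomorphism maps the points of each type onto the points of the same type.
  Conversely, bijections chosen separately for each type glue to one isomorphism, because the types
  partition the domain.\<close>

lemma isomorphic_iff_card_type_points:
  "isomorphic \<tau> n M N \<longleftrightarrow>
     (\<forall>\<pi>\<in>Pow \<tau>. card (type_points \<tau> n M \<pi>) = card (type_points \<tau> n N \<pi>))"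
proof
  assume "isomorphic \<tau> n M N"
  then obtain f where f: "bij_betw f {1..n} {1..n}"
    and iso: "\<forall>P\<in>\<tau>. \<forall>a\<in>{1..n}. a \<in> M P \<longleftrightarrow> f a \<in> N P"
    by (auto simp: isomorphic_def)
  note ty = isomorphic_type_of[OF iso]
  show "\<forall>\<pi>\<in>Pow \<tau>. card (type_points \<tau> n M \<pi>) = card (type_points \<tau> n N \<pi>)"
  proof
    fix \<pi> assume "\<pi> \<in> Pow \<tau>"
    then have sub: "\<pi> \<subseteq> \<tau>" by simp
    have "b \<in> f ` type_points \<tau> n M \<pi>" if b: "b \<in> type_points \<tau> n N \<pi>" for b
    proof -
      have "b \<in> {1..n}" and b': "type_of \<tau> N b = \<pi>"
        using b by (simp_all add: mem_type_points[OF sub])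
      then obtain a where a: "a \<in> {1..n}" "b = f a" using bij_betw_imp_surj_on[OF f] by blast
      then have "a \<in> type_points \<tau> n M \<pi>" using b' ty[of a] by (simp add: mem_type_points[OF sub])
      then show ?thesis using a by blast
    qed
    moreover have "f a \<in> type_points \<tau> n N \<pi>" if "a \<in> type_points \<tau> n M \<pi>" for a
      using that ty[of a] bij_betwE[OF f] by (simp add: mem_type_points[OF sub])
    ultimately have "f ` type_points \<tau> n M \<pi> = type_points \<tau> n N \<pi>" by blast
    moreover have "inj_on f (type_points \<tau> n M \<pi>)"
      by (rule inj_on_subset[OF bij_betw_imp_inj_on[OF f]]) (auto simp: type_points_def)
    ultimately show "card (type_points \<tau> n M \<pi>) = card (type_points \<tau> n N \<pi>)"
      by (metis card_image)
  qed
next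
  assume "\<forall>\<pi>\<in>Pow \<tau>. card (type_points \<tau> n M \<pi>) = card (type_points \<tau> n N \<pi>)"
  then have "\<forall>\<pi>\<in>Pow \<tau>. \<exists>h. bij_betw h (type_points \<tau> n M \<pi>) (type_points \<tau> n N \<pi>)"
    by (simp add: finite_same_card_bij)
  then obtain h where h: "\<And>\<pi>. \<pi> \<in> Pow \<tau> \<Longrightarrow>
      bij_betw (h \<pi>) (type_points \<tau> n M \<pi>) (type_points \<tau> n N \<pi>)"
    by metis
  define f where "f a = h (type_of \<tau> M a) a" for a
  have f: "f a \<in> {1..n}" "type_of \<tau> N (f a) = type_of \<tau> M a" if "a \<in> {1..n}" for a
  proof -
    have "a \<in> type_points \<tau> n M (type_of \<tau> M a)"
      using that by (simp add: mem_type_points type_of_subset)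
    then have "f a \<in> type_points \<tau> n N (type_of \<tau> M a)"
      unfolding f_def using bij_betwE[OF h] by (simp add: type_of_subset)
    then show "f a \<in> {1..n}" "type_of \<tau> N (f a) = type_of \<tau> M a"
      by (simp_all add: mem_type_points type_of_subset)
  qed
  have "inj_on f {1..n}"
  proof (rule inj_onI)
    fix a b assume ab: "a \<in> {1..n}" "b \<in> {1..n}" "f a = f b"
    then have eq: "type_of \<tau> M a = type_of \<tau> M b" using f(2) by metis
    have "a \<in> type_points \<tau> n M (type_of \<tau> M a)" "b \<in> type_points \<tau> n M (type_of \<tau> M a)"
      using ab eq by (simp_all add: mem_type_points type_of_subset)
    moreover have "inj_on (h (type_of \<tau> M a)) (type_points \<tau> n M (type_of \<tau> M a))"
      by (rule bij_betw_imp_inj_on[OF h]) (simp add: type_of_subset)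
    moreover have "h (type_of \<tau> M a) a = h (type_of \<tau> M a) b"
      using ab(3) eq by (simp add: f_def)
    ultimately show "a = b" by (simp add: inj_on_eq_iff)
  qed
  moreover have "f ` {1..n} = {1..n}"
  proof (rule endo_inj_surj)
    show "f ` {1..n} \<subseteq> {1..n}" using f(1) by (rule image_subsetI)
  qed (use calculation in simp_all)
  ultimately have "bij_betw f {1..n} {1..n}" by (simp add: bij_betw_def)
  moreover have "a \<in> M P \<longleftrightarrow> f a \<in> N P" if "P \<in> \<tau>" "a \<in> {1..n}" for P a
    using f(2)[OF that(2)] that(1) by (auto simp: type_of_def)
  ultimately show "isomorphic \<tau> n M N" unfolding isomorphic_def by blast
qed

lemma sat_cong: "(\<And>x. x \<in> free_vars \<phi> \<Longrightarrow> s x = s' x) \<Longrightarrow> sat n M s \<phi> = sat n M s' \<phi>"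
proof (induction \<phi> arbitrary: s s')
  case (Exi x \<phi>)
  have "sat n M (s(x := a)) \<phi> = sat n M (s'(x := a)) \<phi>" for a
    by (rule Exi.IH) (use Exi.prems in auto)
  then show ?case by simp
next
  case (Uni x \<phi>)
  have "sat n M (s(x := a)) \<phi> = sat n M (s'(x := a)) \<phi>" for a
    by (rule Uni.IH) (use Uni.prems in auto)
  then show ?case by simp
next
  case (Conj \<phi> \<psi>)
  have "sat n M s \<phi> = sat n M s' \<phi>"
    by (rule Conj.IH(1)) (use Conj.prems in simp)
  moreover have "sat n M s \<psi> = sat n M s' \<psi>"
    by (rule Conj.IH(2)) (use Conj.prems in simp)
  ultimately show ?case by simp
next
  case (Disj \<phi> \<psi>)
  have "sat n M s \<phi> = sat n M s' \<phi>"
    by (rule Disj.IH(1)) (use Disj.prems in simp)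
  moreover have "sat n M s \<psi> = sat n M s' \<psi>"
    by (rule Disj.IH(2)) (use Disj.prems in simp)
  ultimately show ?case by simp
qed auto

subsection \<open>Entropy of a type distribution with a dominant type\<close>

text \<open>This is \<open>q\<close> times the inequality ln x \<le> x - 1 at x = r / q. The
  correction \<open>(r - q) / ln 2\<close> cancels when summed over two distributions.\<close>

lemma gibbs_term:
  fixes q r :: real
  assumes "q \<ge> 0" "r > 0"
  shows "- q * log 2 q \<le> - q * log 2 r + (r - q) / ln 2"
proof (cases "q = 0")
  case True
  then show ?thesis using assms by simp
next
  case False
  then have q: "q > 0" using assms by simp
  have "ln (r / q) \<le> r / q - 1" by (rule ln_le_minus_one) (use q assms in auto)
  then have "q * ln (r / q) \<le> q * (r / q - 1)" using q by (intro mult_left_mono) auto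
  then have "q * (ln r - ln q) \<le> r - q"
    using q assms by (simp add: ln_div right_diff_distrib)
  then have "q * (ln r - ln q) / ln 2 \<le> (r - q) / ln 2"
    by (intro divide_right_mono) auto
  then show ?thesis by (simp add: log_def field_simps)
qed

text \<open>The right-hand side is the entropy of the distribution \<open>r\<close> with value a = 1
  - (t - 1) p at \<open>i\<close> and \<open>p\<close> elsewhere. Gibbs' inequality bounds the
  entropy of \<open>q\<close> by its cross-entropy against \<open>r\<close>, which depends on
  \<open>q i\<close> alone and decreases in it since p < a. So its value at \<open>q i = a\<close>
  is an upper bound.\<close>

lemma entropy_le_if_dominant:
  fixes q :: "'a \<Rightarrow> real"
  assumes fin: "finite S" and i: "i \<in> S" and nonneg: "\<And>j. j \<in> S \<Longrightarrow> q j \<ge> 0"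
    and sum1: "sum q S = 1" and t: "t = real (card S)" and p: "0 \<le> p" "p < 1 / t"
    and dom: "q i \<ge> 1 - (t - 1) * p"
  shows "(\<Sum>j\<in>S. - q j * log 2 (q j))
           \<le> ((t - 1) * p - 1) * log 2 (1 - (t - 1) * p) - (t - 1) * p * log 2 p"
proof -
  have t0: "t \<ge> 1" 
    using fin i t card_gt_0_iff[of S] by (auto simp: Suc_le_eq)
  have sum': "sum q S = q i + sum q (S - {i})" using fin i by (rule sum.remove)
  \<comment> \<open>For \<open>p = 0\<close> the comparison distribution would have zero entries,
    which \<open>gibbs_term\<close> excludes. In that case all mass sits on \<open>i\<close> and
    both sides are 0.\<close>
  show ?thesis
  proof (cases "p = 0")
    case True
    have "sum q (S - {i}) \<ge> 0" by (rule sum_nonneg) (use nonneg in auto)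
    then have "q i = 1" "sum q (S - {i}) = 0" using sum' sum1 dom True by auto
    then have "q j = 0" if "j \<in> S - {i}" for j
      using that nonneg fin sum_nonneg_eq_0_iff[of "S - {i}" q] by auto
    then have "q j = 0 \<or> q j = 1" if "j \<in> S" for j
      using \<open>q i = 1\<close> that by (cases "j = i") auto
    then have "(\<Sum>j\<in>S. - q j * log 2 (q j)) = 0"
      by (intro sum.neutral ballI) fastforce
    then show ?thesis using True by simp
  next
    case False
    then have p0: "p > 0" using p by simp
    define a where "a = 1 - (t - 1) * p"
    have "t * p < 1" using p t0 by (simp add: field_simps)
    then have pa: "p < a" by (simp add: a_def algebra_simps)
    define r where "r j = (if j = i then a else p)" for j
    have sumr: "sum r S = 1"
    proof -
      have "sum r S = r i + sum r (S - {i})" using fin i by (rule sum.remove)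
      also have "sum r (S - {i}) = (\<Sum>j\<in>S - {i}. p)" by (rule sum.cong) (auto simp: r_def)
      also have "\<dots> = (t - 1) * p"
        using fin i t t0 by (simp add: card_Diff_singleton of_nat_diff)
      finally show ?thesis by (simp add: r_def a_def)
    qed
    have "(\<Sum>j\<in>S. - q j * log 2 (q j)) \<le> (\<Sum>j\<in>S. - q j * log 2 (r j) + (r j - q j) / ln 2)"
      by (intro sum_mono gibbs_term nonneg) (use p0 pa in \<open>auto simp: r_def\<close>)
    also have "\<dots> = (\<Sum>j\<in>S. - q j * log 2 (r j)) + (sum r S - sum q S) / ln 2"
      by (simp only: sum.distrib sum_subtractf sum_divide_distrib[symmetric])
    also have "\<dots> = (\<Sum>j\<in>S. - q j * log 2 (r j))" using sumr sum1 by simp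
    also have "\<dots> = - q i * log 2 (r i) + (\<Sum>j\<in>S - {i}. - q j * log 2 (r j))"
      using fin i by (rule sum.remove)
    also have "(\<Sum>j\<in>S - {i}. - q j * log 2 (r j)) = (\<Sum>j\<in>S - {i}. q j * - log 2 p)"
      by (rule sum.cong) (auto simp: r_def)
    also have "\<dots> = sum q (S - {i}) * - log 2 p" by (simp only: sum_distrib_right)
    also have "sum q (S - {i}) = 1 - q i" using sum' sum1 by simp
    finally have "(\<Sum>j\<in>S. - q j * log 2 (q j)) \<le> - q i * log 2 a + (1 - q i) * - log 2 p"
      by (simp add: r_def)
    also have "\<dots> = - log 2 p - q i * (log 2 a - log 2 p)" by (simp add: algebra_simps)
    also have "\<dots> \<le> - log 2 p - a * (log 2 a - log 2 p)"
      using dom pa p0 by (intro diff_left_mono mult_right_mono) (auto simp: a_def)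
    also have "\<dots> = ((t - 1) * p - 1) * log 2 (1 - (t - 1) * p) - (t - 1) * p * log 2 p"
      by (simp add: a_def algebra_simps)
    finally show ?thesis .
  qed
qed

text \<open>The contrapositive of the previous lemma for the type frequencies. Both bounds use the
  entropy only through this cap on the class sizes.\<close>

lemma card_type_points_less_if_entropy:
  fixes t p :: real
  assumes fin: "finite \<tau>" and t: "t = 2 ^ card \<tau>" and n: "n \<ge> 1" and p: "p \<in> {0..<1 / t}"
    and ent: "entropy_S \<tau> n M
           > ((t - 1) * p - 1) * log 2 (1 - (t - 1) * p) - (t - 1) * p * log 2 p"
    and \<pi>: "\<pi> \<subseteq> \<tau>"
  shows "real (card (type_points \<tau> n M \<pi>)) < real n * (1 - (t - 1) * p)"
proof (rule ccontr)
  define q where "q \<rho> = real (card (type_points \<tau> n M \<rho>)) / real n" for \<rho>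
  assume "\<not> ?thesis"
  then have dom: "q \<pi> \<ge> 1 - (t - 1) * p" using n by (simp add: q_def field_simps)
  have "sum q (Pow \<tau>) = real (\<Sum>\<rho>\<in>Pow \<tau>. card (type_points \<tau> n M \<rho>)) / real n"
    by (simp add: q_def sum_divide_distrib)
  then have sum1: "sum q (Pow \<tau>) = 1" using n by (simp add: sum_card_type_points[OF fin])
  have "(\<Sum>\<rho>\<in>Pow \<tau>. - q \<rho> * log 2 (q \<rho>))
           \<le> ((t - 1) * p - 1) * log 2 (1 - (t - 1) * p) - (t - 1) * p * log 2 p"
  proof (rule entropy_le_if_dominant[where i = \<pi>])
    show "q \<rho> \<ge> 0" for \<rho> by (simp add: q_def)
    show "t = real (card (Pow \<tau>))" by (simp add: t card_Pow fin)
  qed (use fin \<pi> sum1 p dom in auto)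
  then show False using ent by (simp add: entropy_S_def q_def)
qed

subsection \<open>A short describing formula\<close>

lemma ex_type_formula:
  assumes "finite T"
  shows "\<exists>\<phi>. fo_size \<phi> = 2 * card T + 1 \<and> symbols \<phi> \<subseteq> T \<and> free_vars \<phi> = {y} \<and>
    (\<forall>n M s. sat n M s \<phi> \<longleftrightarrow> (\<forall>P\<in>T. s y \<in> M P \<longleftrightarrow> P \<in> \<pi>))"
  using assms
proof induction
  case empty
  \<comment> \<open>\<open>Eq y y\<close> plays the role of the constant true and is the
    \<open>+ 1\<close> in the size.\<close>
  show ?case by (rule exI[of _ "Eq y y"]) auto
next
  case (insert P T)
  then obtain \<phi> where "fo_size \<phi> = 2 * card T + 1" "symbols \<phi> \<subseteq> T" "free_vars \<phi> = {y}"
    "\<forall>n M s. sat n M s \<phi> \<longleftrightarrow> (\<forall>P\<in>T. s y \<in> M P \<longleftrightarrow> P \<in> \<pi>)" by blast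
  then show ?case using insert.hyps
    by (intro exI[of _ "Conj (if P \<in> \<pi> then Rel P y else NRel P y) \<phi>"]) auto
qed

text \<open>Referring to the type of another point treats all types at once, so that the long
  quantifier block has to be written only once.\<close>

lemma ex_same_type_formula:
  assumes "finite T"
  shows "\<exists>\<phi>. fo_size \<phi> = 8 * card T + 1 \<and> symbols \<phi> \<subseteq> T \<and> free_vars \<phi> \<subseteq> {y, z} \<and>
    (\<forall>n M s. sat n M s \<phi> \<longleftrightarrow> (\<forall>P\<in>T. s y \<in> M P \<longleftrightarrow> s z \<in> M P))"
  using assms
proof induction
  case empty
  show ?case by (rule exI[of _ "Eq y y"]) auto
next
  case (insert P T)
  then obtain \<phi> where "fo_size \<phi> = 8 * card T + 1" "symbols \<phi> \<subseteq> T" "free_vars \<phi> \<subseteq> {y, z}"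
    "\<forall>n M s. sat n M s \<phi> \<longleftrightarrow> (\<forall>P\<in>T. s y \<in> M P \<longleftrightarrow> s z \<in> M P)" by blast
  then show ?case using insert.hyps
    \<comment> \<open>A biconditional in negation normal form: four literals, two disjunctions, one
      inner conjunction and one that attaches it to \<open>\<phi>\<close>, hence 8 per
      symbol.\<close>
    by (intro exI[of _ "Conj (Conj (Disj (Rel P y) (NRel P z)) (Disj (NRel P y) (Rel P z))) \<phi>"]) auto
qed

text \<open>Points whose type lies in \<open>S\<close> are exempted from \<open>\<chi>\<close>. This
  is how a type leaves the chain of inequations below.\<close>

lemma ex_disj_types_formula:
  assumes "finite \<tau>" "finite S" "S \<subseteq> Pow \<tau>" "symbols \<chi> \<subseteq> \<tau>"
  shows "\<exists>\<phi>. fo_size \<phi> = fo_size \<chi> + (2 * card \<tau> + 2) * card S \<and> symbols \<phi> \<subseteq> \<tau> \<and>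
    free_vars \<phi> \<subseteq> insert y (free_vars \<chi>) \<and>
    (\<forall>n M s. sat n M s \<phi> \<longleftrightarrow> type_of \<tau> M (s y) \<in> S \<or> sat n M s \<chi>)"
  using assms(2,3)
proof induction
  case empty
  show ?case by (rule exI[of _ \<chi>]) (simp add: assms(4) subset_insertI)
next
  case (insert \<pi> S)
  then have "S \<subseteq> Pow \<tau>" by simp
  from insert.IH[OF this] obtain \<phi> where \<phi>: "fo_size \<phi> = fo_size \<chi> + (2 * card \<tau> + 2) * card S" "symbols \<phi> \<subseteq> \<tau>"
    "free_vars \<phi> \<subseteq> insert y (free_vars \<chi>)"
    "\<forall>n M s. sat n M s \<phi> \<longleftrightarrow> type_of \<tau> M (s y) \<in> S \<or> sat n M s \<chi>"
    by (elim exE conjE)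
  from ex_type_formula[OF assms(1), of y \<pi>]
  obtain \<theta> where \<theta>: "fo_size \<theta> = 2 * card \<tau> + 1" "symbols \<theta> \<subseteq> \<tau>" "free_vars \<theta> = {y}"
    "\<forall>n (M :: 'a interp) s. sat n M s \<theta> \<longleftrightarrow> (\<forall>P\<in>\<tau>. s y \<in> M P \<longleftrightarrow> P \<in> \<pi>)"
    by (elim exE conjE)
  have "(\<forall>P\<in>\<tau>. a \<in> M P \<longleftrightarrow> P \<in> \<pi>) \<longleftrightarrow> type_of \<tau> M a = \<pi>" for M :: "'a interp" and a
    using insert.prems by (auto simp: type_of_def)
  with \<theta>(4) have "\<forall>n (M :: 'a interp) s. sat n M s \<theta> \<longleftrightarrow> type_of \<tau> M (s y) = \<pi>" by simp
  then show ?case using insert.hyps \<phi> \<theta>(1-3)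
    by (intro exI[of _ "Disj \<theta> \<phi>"]) (simp add: disj_assoc)
qed

lemma ex_realized_types_formula:
  assumes "finite \<tau>" "finite S" "S \<subseteq> Pow \<tau>" "symbols \<chi> \<subseteq> \<tau>"
  shows "\<exists>\<phi>. fo_size \<phi> = fo_size \<chi> + (2 * card \<tau> + 3) * card S \<and> symbols \<phi> \<subseteq> \<tau> \<and>
    free_vars \<phi> \<subseteq> free_vars \<chi> \<and>
    (\<forall>n M s. sat n M s \<phi> \<longleftrightarrow> (\<forall>\<pi>\<in>S. type_points \<tau> n M \<pi> \<noteq> {}) \<and> sat n M s \<chi>)"
  using assms(2,3)
proof induction
  case empty
  show ?case by (rule exI[of _ \<chi>]) (simp add: assms(4) subset_insertI)
next
  case (insert \<pi> S)
  then have "S \<subseteq> Pow \<tau>" by simp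
  from insert.IH[OF this] obtain \<phi> where \<phi>: "fo_size \<phi> = fo_size \<chi> + (2 * card \<tau> + 3) * card S" "symbols \<phi> \<subseteq> \<tau>"
    "free_vars \<phi> \<subseteq> free_vars \<chi>"
    "\<forall>n M s. sat n M s \<phi> \<longleftrightarrow> (\<forall>\<pi>\<in>S. type_points \<tau> n M \<pi> \<noteq> {}) \<and> sat n M s \<chi>"
    by (elim exE conjE)
  from ex_type_formula[OF assms(1), of 0 \<pi>]
  obtain \<theta> where \<theta>: "fo_size \<theta> = 2 * card \<tau> + 1" "symbols \<theta> \<subseteq> \<tau>" "free_vars \<theta> = {0}"
    "\<forall>n (M :: 'a interp) s. sat n M s \<theta> \<longleftrightarrow> (\<forall>P\<in>\<tau>. s 0 \<in> M P \<longleftrightarrow> P \<in> \<pi>)"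
    by (elim exE conjE)
  have "\<forall>n (M :: 'a interp) s. sat n M s (Exi 0 \<theta>) \<longleftrightarrow> type_points \<tau> n M \<pi> \<noteq> {}"
    unfolding type_points_def sat.simps \<theta>(4)[rule_format] by auto
  then show ?case using insert.hyps \<phi> \<theta>(1-3)
    by (intro exI[of _ "Conj (Exi 0 \<theta>) \<phi>"]) (simp del: sat.simps(7) add: conj_assoc)
qed

text \<open>The inequations are shared between all types: a type with threshold \<open>h \<pi>\<close> leaves the
  chain of conjunctions after it has passed the variables \<open>j + 2\<close> with \<open>h \<pi> \<le> j < d\<close>.\<close>

lemma ex_avoid_formula:
  fixes h :: "'r set \<Rightarrow> nat"
  assumes fin: "finite \<tau>"
  shows "\<exists>\<phi>. fo_size \<phi> = 2 * d + 1 + (2 * card \<tau> + 2) * card {\<pi> \<in> Pow \<tau>. h \<pi> \<in> {1..d}} \<and>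
    symbols \<phi> \<subseteq> \<tau> \<and> free_vars \<phi> \<subseteq> insert 0 {2..<d + 2} \<and>
    (\<forall>n M s. h (type_of \<tau> M (s 0)) \<le> d \<longrightarrow>
      (sat n M s \<phi> \<longleftrightarrow> (\<forall>j\<in>{h (type_of \<tau> M (s 0))..<d}. s 0 \<noteq> s (j + 2))))"
proof (induction d)
  case 0
  show ?case by (rule exI[of _ "Eq 0 0"]) auto
next
  case (Suc d)
  then obtain \<phi> where \<phi>:
    "fo_size \<phi> = 2 * d + 1 + (2 * card \<tau> + 2) * card {\<pi> \<in> Pow \<tau>. h \<pi> \<in> {1..d}}"
    "symbols \<phi> \<subseteq> \<tau>" "free_vars \<phi> \<subseteq> insert 0 {2..<d + 2}"
    and sat: "\<And>n M s. h (type_of \<tau> M (s 0)) \<le> d \<Longrightarrow>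
      (sat n M s \<phi> \<longleftrightarrow> (\<forall>j\<in>{h (type_of \<tau> M (s 0))..<d}. s 0 \<noteq> s (j + 2)))" by blast
  \<comment> \<open>The new inequation becomes the outermost one. Types with threshold
    \<open>Suc d\<close> leave just before it, all others with threshold at most \<open>d\<close>
    must pass it.\<close>
  define S where "S = {\<pi> \<in> Pow \<tau>. h \<pi> = Suc d}"
  have S: "finite S" "S \<subseteq> Pow \<tau>" using fin by (auto simp: S_def)
  have "{\<pi> \<in> Pow \<tau>. h \<pi> \<in> {1..Suc d}} = {\<pi> \<in> Pow \<tau>. h \<pi> \<in> {1..d}} \<union> S"
    by (auto simp: S_def)
  also have "card \<dots> = card {\<pi> \<in> Pow \<tau>. h \<pi> \<in> {1..d}} + card S"
    by (rule card_Un_disjoint) (use fin in \<open>auto simp: S_def\<close>)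
  finally have card: "card {\<pi> \<in> Pow \<tau>. h \<pi> \<in> {1..Suc d}} = card {\<pi> \<in> Pow \<tau>. h \<pi> \<in> {1..d}} + card S" .
  have "symbols (Conj (NEq 0 (d + 2)) \<phi>) \<subseteq> \<tau>" using \<phi> by simp
  from ex_disj_types_formula[OF fin S this, of 0] obtain \<psi> where \<psi>:
    "fo_size \<psi> = fo_size (Conj (NEq 0 (d + 2)) \<phi>) + (2 * card \<tau> + 2) * card S" "symbols \<psi> \<subseteq> \<tau>"
    "free_vars \<psi> \<subseteq> insert 0 (free_vars (Conj (NEq 0 (d + 2)) \<phi>))"
    and sat\<psi>: "\<And>n M s. sat n M s \<psi> \<longleftrightarrow>
      type_of \<tau> M (s 0) \<in> S \<or> sat n M s (Conj (NEq 0 (d + 2)) \<phi>)" by blast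
  have "sat n M s \<psi> \<longleftrightarrow> (\<forall>j\<in>{h (type_of \<tau> M (s 0))..<Suc d}. s 0 \<noteq> s (j + 2))"
    if le: "h (type_of \<tau> M (s 0)) \<le> Suc d" for n M s
  proof (cases "h (type_of \<tau> M (s 0)) = Suc d")
    case True
    then show ?thesis using sat\<psi> by (auto simp: S_def type_of_subset)
  next
    case False
    then have "h (type_of \<tau> M (s 0)) \<le> d" using le by simp
    moreover from this have "{h (type_of \<tau> M (s 0))..<Suc d} = insert d {h (type_of \<tau> M (s 0))..<d}"
      by auto
    ultimately show ?thesis using sat\<psi>[of n M s] sat[of M s n] False by (simp add: S_def)
  qed
  moreover have "fo_size \<psi> = 2 * Suc d + 1 + (2 * card \<tau> + 2) * card {\<pi> \<in> Pow \<tau>. h \<pi> \<in> {1..Suc d}}"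
    unfolding card \<psi>(1) using \<phi>(1) by (simp add: distrib_left)
  moreover have "free_vars \<psi> \<subseteq> insert 0 {2..<Suc d + 2}" using \<psi>(3) \<phi>(3) by fastforce
  ultimately show ?case using \<psi>(2) by blast
qed

section \<open>Blocks of universal quantifiers\<close>

text \<open>The numbering starts at 2: variable 0 is kept for the witness and variable 1 for the
  point whose type it copies.\<close>

fun unis :: "nat \<Rightarrow> 'r fo \<Rightarrow> 'r fo" where
  "unis 0 \<phi> = \<phi>"
| "unis (Suc d) \<phi> = Uni (d + 2) (unis d \<phi>)"

lemma fo_size_unis [simp]: "fo_size (unis d \<phi>) = fo_size \<phi> + d"
  by (induction d) auto

lemma symbols_unis [simp]: "symbols (unis d \<phi>) = symbols \<phi>"
  by (induction d) auto

lemma free_vars_unis [simp]: "free_vars (unis d \<phi>) = free_vars \<phi> - {2..<d + 2}"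
proof (induction d)
  case (Suc d)
  have "{2..<Suc d + 2} = insert (d + 2) {2..<d + 2}" by auto
  then show ?case by (simp only: unis.simps free_vars.simps Suc.IH) blast
qed simp

text \<open>The whole block turns into one quantifier over a tuple \<open>g\<close>, which can then
  be instantiated at once by an enumeration of the points of a type.\<close>

lemma sat_unis:
  "sat n M s (unis d \<phi>) \<longleftrightarrow>
    (\<forall>g. (\<forall>j<d. g j \<in> {1..n}) \<longrightarrow>
       sat n M (\<lambda>x. if x \<in> {2..<d + 2} then g (x - 2) else s x) \<phi>)"
proof (induction d arbitrary: s)
  case 0
  show ?case by simp
next
  case (Suc d)
  have eq: "(\<lambda>x. if x \<in> {2..<d + 2} then g (x - 2) else (s(d + 2 := a)) x) =
      (\<lambda>x. if x \<in> {2..<Suc d + 2} then (g(d := a)) (x - 2) else s x)" for g and a :: nat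
    by (auto simp: fun_eq_iff)
  have "sat n M s (unis (Suc d) \<phi>) \<longleftrightarrow> (\<forall>a\<in>{1..n}. \<forall>g. (\<forall>j<d. g j \<in> {1..n}) \<longrightarrow>
       sat n M (\<lambda>x. if x \<in> {2..<Suc d + 2} then (g(d := a)) (x - 2) else s x) \<phi>)"
    by (simp only: unis.simps sat.simps Suc.IH eq)
  also have "\<dots> \<longleftrightarrow> (\<forall>g. (\<forall>j<Suc d. g j \<in> {1..n}) \<longrightarrow>
       sat n M (\<lambda>x. if x \<in> {2..<Suc d + 2} then g (x - 2) else s x) \<phi>)" (is "?L \<longleftrightarrow> ?R")
  proof
    assume L: ?L
    show ?R
    proof (intro allI impI)
      fix g assume g: "\<forall>j<Suc d. g j \<in> {1..n}"
      then have "sat n M (\<lambda>x. if x \<in> {2..<Suc d + 2} then (g(d := g d)) (x - 2) else s x) \<phi>"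
        using L by (metis lessI less_Suc_eq)
      then show "sat n M (\<lambda>x. if x \<in> {2..<Suc d + 2} then g (x - 2) else s x) \<phi>"
        by (simp only: fun_upd_triv)
    qed
  next
    assume R: ?R
    show ?L
    proof (intro ballI allI impI)
      fix a g assume "a \<in> {1..n}" "\<forall>j<d. g j \<in> {1..n}"
      then have "\<forall>j<Suc d. (g(d := a)) j \<in> {1..n}" by (auto simp: less_Suc_eq)
      then show "sat n M (\<lambda>x. if x \<in> {2..<Suc d + 2} then (g(d := a)) (x - 2) else s x) \<phi>"
        using R by blast
    qed
  qed
  finally show ?case .
qed

text \<open>For a point of type \<pi>, the formula asks for a point of the same type that avoids
  \<open>k \<pi> - 1\<close> of the values \<open>x\<close>. With \<open>k \<pi>\<close> points one
  is always left; with fewer, the \<open>x\<close> can list them all. A type without points is never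
  the type of the second point, so its realization has to be assumed. Each \<open>x\<close> costs a
  quantifier, an inequation and a conjunction, hence the factor 3.\<close>

lemma ex_at_least_formula:
  fixes k :: "'r set \<Rightarrow> nat"
  assumes fin: "finite \<tau>" and bound: "\<forall>\<pi>\<in>Pow \<tau>. k \<pi> \<le> m"
  shows "\<exists>\<phi>. fo_size \<phi> \<le> 3 * (m - 1) + (2 * card \<tau> + 2) * 2 ^ card \<tau> + 8 * card \<tau> + 5 \<and>
    is_sentence \<tau> \<phi> \<and>
    (\<forall>n N s. (\<forall>\<pi>\<in>Pow \<tau>. card (type_points \<tau> n N \<pi>) = k \<pi>) \<longrightarrow> sat n N s \<phi>) \<and>
    (\<forall>n N s. sat n N s \<phi> \<longrightarrow> (\<forall>\<pi>\<in>Pow \<tau>. k \<pi> > 0 \<longrightarrow> type_points \<tau> n N \<pi> \<noteq> {}) \<longrightarrow>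
      (\<forall>\<pi>\<in>Pow \<tau>. k \<pi> \<le> card (type_points \<tau> n N \<pi>)))"
proof -
  have m: "k \<pi> \<le> m" if "\<pi> \<subseteq> \<tau>" for \<pi> using bound that by simp
  define d where "d = m - 1"
  \<comment> \<open>If \<open>k \<pi> > 0\<close>, then \<open>d - h \<pi> = k \<pi> - 1\<close>
    inequations remain for \<pi>.\<close>
  define h where "h \<pi> = m - k \<pi>" for \<pi>
  obtain \<chi> where \<chi>: "fo_size \<chi> = 2 * d + 1 + (2 * card \<tau> + 2) * card {\<pi> \<in> Pow \<tau>. h \<pi> \<in> {1..d}}"
    "symbols \<chi> \<subseteq> \<tau>" "free_vars \<chi> \<subseteq> insert 0 {2..<d + 2}"
    and sat\<chi>: "\<forall>n M s. h (type_of \<tau> M (s 0)) \<le> d \<longrightarrow>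
      (sat n M s \<chi> \<longleftrightarrow> (\<forall>j\<in>{h (type_of \<tau> M (s 0))..<d}. s 0 \<noteq> s (j + 2)))"
    using ex_avoid_formula[OF fin, of d h] by (elim exE conjE)
  obtain \<theta> where \<theta>: "fo_size \<theta> = 8 * card \<tau> + 1" "symbols \<theta> \<subseteq> \<tau>" "free_vars \<theta> \<subseteq> {0, 1}"
    and sat\<theta>: "\<forall>n (M :: 'r interp) s. sat n M s \<theta> \<longleftrightarrow> (\<forall>P\<in>\<tau>. s 0 \<in> M P \<longleftrightarrow> s 1 \<in> M P)"
    using ex_same_type_formula[OF fin, of 0 1] by (elim exE conjE)
  define \<phi> where "\<phi> = unis d (Uni 1 (Exi 0 (Conj \<theta> \<chi>)))"
  have "card {\<pi> \<in> Pow \<tau>. h \<pi> \<in> {1..d}} \<le> card (Pow \<tau>)"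
    by (rule card_mono) (use fin in auto)
  then have "(2 * card \<tau> + 2) * card {\<pi> \<in> Pow \<tau>. h \<pi> \<in> {1..d}} \<le> (2 * card \<tau> + 2) * 2 ^ card \<tau>"
    by (intro mult_le_mono2) (simp add: card_Pow fin)
  then have size: "fo_size \<phi> \<le> 3 * (m - 1) + (2 * card \<tau> + 2) * 2 ^ card \<tau> + 8 * card \<tau> + 5"
    using \<chi>(1) \<theta>(1) by (simp add: \<phi>_def d_def)
  have "free_vars \<phi> = {}"
    using \<chi>(3) \<theta>(3) unfolding \<phi>_def free_vars_unis free_vars.simps by blast
  then have sentence: "is_sentence \<tau> \<phi>"
    using \<chi>(2) \<theta>(2) by (simp add: is_sentence_def \<phi>_def)
  define st where "st s g b a =
      (\<lambda>x. if x \<in> {2..<d + 2} then g (x - 2) else s x)(1 := b, 0 := a)"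
    for s g :: "nat \<Rightarrow> nat" and b a
  have sat\<phi>: "sat n N s \<phi> \<longleftrightarrow> (\<forall>g. (\<forall>j<d. g j \<in> {1..n}) \<longrightarrow>
      (\<forall>b\<in>{1..n}. \<exists>a\<in>{1..n}. sat n N (st s g b a) \<theta> \<and> sat n N (st s g b a) \<chi>))" for n N s
    by (simp only: \<phi>_def sat_unis sat.simps st_def)
  have sat_\<theta>: "sat n N (st s g b a) \<theta> \<longleftrightarrow> type_of \<tau> N a = type_of \<tau> N b" for n N s g b a
    by (simp only: sat\<theta>[rule_format]) (auto simp: st_def type_of_def)
  have sat_\<chi>: "sat n N (st s g b a) \<chi> \<longleftrightarrow> (\<forall>j\<in>{h (type_of \<tau> N a)..<d}. a \<noteq> g j)"
    if "k (type_of \<tau> N a) > 0" for n N s g b a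
  proof -
    have "h (type_of \<tau> N (st s g b a 0)) \<le> d" using that by (simp add: st_def h_def d_def)
    then have "sat n N (st s g b a) \<chi> \<longleftrightarrow>
        (\<forall>j\<in>{h (type_of \<tau> N (st s g b a 0))..<d}. st s g b a 0 \<noteq> st s g b a (j + 2))"
      by (rule sat\<chi>[rule_format])
    also have "\<dots> \<longleftrightarrow> (\<forall>j\<in>{h (type_of \<tau> N a)..<d}. a \<noteq> g j)"
      by (intro ball_cong) (simp_all add: st_def)
    finally show ?thesis .
  qed
  have "sat n N s \<phi>" if k: "\<forall>\<pi>\<in>Pow \<tau>. card (type_points \<tau> n N \<pi>) = k \<pi>" for n N s
    unfolding sat\<phi>
  proof (intro allI impI ballI)
    fix g :: "nat \<Rightarrow> nat" and b assume b: "b \<in> {1..n}"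
    define \<pi> where "\<pi> = type_of \<tau> N b"
    have \<pi>: "\<pi> \<subseteq> \<tau>" by (simp add: \<pi>_def type_of_subset)
    then have k\<pi>: "card (type_points \<tau> n N \<pi>) = k \<pi>" using k by simp
    have "b \<in> type_points \<tau> n N \<pi>" using b by (simp add: mem_type_points \<pi> \<pi>_def[symmetric])
    then have pos: "k \<pi> > 0" using k\<pi> card_gt_0_iff[of "type_points \<tau> n N \<pi>"] by auto
    \<comment> \<open>Pigeonhole: at most \<open>k \<pi> - 1\<close> values cannot cover
      \<open>k \<pi>\<close> points.\<close>
    have "card (g ` {h \<pi>..<d}) \<le> card {h \<pi>..<d}" by (rule card_image_le) simp
    also have "\<dots> < k \<pi>" using pos m[OF \<pi>] by (simp add: h_def d_def)
    finally have "\<not> type_points \<tau> n N \<pi> \<subseteq> g ` {h \<pi>..<d}"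
      using k\<pi> card_mono[of "g ` {h \<pi>..<d}" "type_points \<tau> n N \<pi>"] by auto
    then obtain a where "a \<in> type_points \<tau> n N \<pi>" and avoid: "a \<notin> g ` {h \<pi>..<d}" by blast
    then have a: "a \<in> {1..n}" "type_of \<tau> N a = \<pi>" by (simp_all add: mem_type_points \<pi>)
    have "\<forall>j\<in>{h \<pi>..<d}. a \<noteq> g j" using avoid by blast
    then show "\<exists>a\<in>{1..n}. sat n N (st s g b a) \<theta> \<and> sat n N (st s g b a) \<chi>"
      using a pos by (intro bexI[of _ a]) (simp_all add: sat_\<theta> sat_\<chi> \<pi>_def)
  qed
  moreover have "k \<pi> \<le> card (type_points \<tau> n N \<pi>)"
    if sat: "sat n N s \<phi>" and real: "\<forall>\<pi>\<in>Pow \<tau>. k \<pi> > 0 \<longrightarrow> type_points \<tau> n N \<pi> \<noteq> {}"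
      and \<pi>: "\<pi> \<in> Pow \<tau>" for n N s \<pi>
  proof (rule ccontr)
    assume less: "\<not> ?thesis"
    have \<pi>': "\<pi> \<subseteq> \<tau>" using \<pi> by simp
    have pos: "k \<pi> > 0" using less by simp
    then obtain b where b: "b \<in> type_points \<tau> n N \<pi>" using real \<pi> by blast
    obtain f where f: "bij_betw f {0..<card (type_points \<tau> n N \<pi>)} (type_points \<tau> n N \<pi>)"
      using ex_bij_betw_nat_finite[OF finite_type_points] by blast
    \<comment> \<open>From position \<open>h \<pi>\<close> on, the tuple runs through all points of
      type \<pi>; the remaining entries are filled with points of the same type.\<close>
    define g where "g j = (if j - h \<pi> < card (type_points \<tau> n N \<pi>) then f (j - h \<pi>) else b)" for j
    have "g j \<in> type_points \<tau> n N \<pi>" for j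
      using bij_betwE[OF f] b by (simp add: g_def)
    then have g: "\<forall>j<d. g j \<in> {1..n}" by (simp add: mem_type_points[OF \<pi>'])
    have b': "b \<in> {1..n}" "type_of \<tau> N b = \<pi>"
      using b by (simp_all add: mem_type_points[OF \<pi>'])
    from sat[unfolded sat\<phi>, THEN spec, THEN mp, OF g, THEN bspec, OF b'(1)]
    obtain a where a: "a \<in> {1..n}" "sat n N (st s g b a) \<theta>" "sat n N (st s g b a) \<chi>" by blast
    have a': "type_of \<tau> N a = \<pi>" using a(2) b'(2) by (simp add: sat_\<theta>)
    then have avoid: "\<forall>j\<in>{h \<pi>..<d}. a \<noteq> g j" using a(3) pos sat_\<chi>[of N a] by simp
    have "a \<in> type_points \<tau> n N \<pi>" using a(1) a' by (simp add: mem_type_points[OF \<pi>'])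
    then obtain i where i: "i < card (type_points \<tau> n N \<pi>)" "a = f i"
      using bij_betw_imp_surj_on[OF f] by force
    \<comment> \<open>There are at most \<open>k \<pi> - 1 = d - h \<pi>\<close> points, so the
      enumeration fits below \<open>d\<close>.\<close>
    have "i + h \<pi> < d" using i less m[OF \<pi>'] by (simp add: h_def d_def)
    then have "a \<noteq> g (i + h \<pi>)" using avoid by simp
    then show False using i by (simp add: g_def)
  qed
  ultimately show ?thesis using size sentence by (intro exI[of _ \<phi>] conjI allI impI ballI)
qed

lemma sum_le_imp_eq:
  fixes f g :: "'a \<Rightarrow> nat"
  assumes "finite S" "\<And>x. x \<in> S \<Longrightarrow> f x \<le> g x" "sum f S = sum g S" "x \<in> S"
  shows "f x = g x"
proof (rule ccontr)
  assume "f x \<noteq> g x"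
  then have "f x < g x" using assms(2,4) le_neq_implies_less by blast
  then have "sum f S < sum g S"
    using assms by (intro sum_strict_mono_ex1) auto
  then show False using assms(3) by simp
qed

lemma ex_describing_formula:
  assumes fin: "finite \<tau>" and n: "n \<ge> 1"
    and m: "\<And>\<pi>. \<pi> \<subseteq> \<tau> \<Longrightarrow> card (type_points \<tau> n M \<pi>) \<le> m"
  shows "\<exists>\<phi>. describes \<tau> n \<phi> M \<and>
    fo_size \<phi> \<le> 3 * (m - 1) + (4 * card \<tau> + 5) * 2 ^ card \<tau> + 8 * card \<tau> + 5"
proof -
  define k where "k \<pi> = card (type_points \<tau> n M \<pi>)" for \<pi>
  define S where "S = {\<pi> \<in> Pow \<tau>. k \<pi> > 0}"
  have k: "\<forall>\<pi>\<in>Pow \<tau>. k \<pi> \<le> m" using m by (simp add: k_def)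
  obtain \<chi> where \<chi>: "fo_size \<chi> \<le> 3 * (m - 1) + (2 * card \<tau> + 2) * 2 ^ card \<tau> + 8 * card \<tau> + 5"
    "is_sentence \<tau> \<chi>"
    and sat\<chi>: "\<forall>n N s. (\<forall>\<pi>\<in>Pow \<tau>. card (type_points \<tau> n N \<pi>) = k \<pi>) \<longrightarrow> sat n N s \<chi>"
    and \<chi>_imp: "\<forall>n N s. sat n N s \<chi> \<longrightarrow> (\<forall>\<pi>\<in>Pow \<tau>. k \<pi> > 0 \<longrightarrow> type_points \<tau> n N \<pi> \<noteq> {}) \<longrightarrow>
      (\<forall>\<pi>\<in>Pow \<tau>. k \<pi> \<le> card (type_points \<tau> n N \<pi>))"
    using ex_at_least_formula[of \<tau> k m, OF fin k] by (elim exE conjE)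
  have S: "finite S" "S \<subseteq> Pow \<tau>" using fin by (auto simp: S_def)
  have "symbols \<chi> \<subseteq> \<tau>" using \<chi>(2) by (simp add: is_sentence_def)
  from ex_realized_types_formula[OF fin S this]
  obtain \<phi> where \<phi>: "fo_size \<phi> = fo_size \<chi> + (2 * card \<tau> + 3) * card S" "symbols \<phi> \<subseteq> \<tau>"
    "free_vars \<phi> \<subseteq> free_vars \<chi>"
    and sat\<phi>: "\<forall>n N s. sat n N s \<phi> \<longleftrightarrow> (\<forall>\<pi>\<in>S. type_points \<tau> n N \<pi> \<noteq> {}) \<and> sat n N s \<chi>"
    by (elim exE conjE)
  have sentence: "is_sentence \<tau> \<phi>" using \<phi>(2,3) \<chi>(2) by (simp add: is_sentence_def)
  have "true_in n N \<phi> \<longleftrightarrow> isomorphic \<tau> n M N" for N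
  proof
    assume "isomorphic \<tau> n M N"
    then have eq: "\<forall>\<pi>\<in>Pow \<tau>. card (type_points \<tau> n N \<pi>) = k \<pi>"
      by (simp add: isomorphic_iff_card_type_points k_def)
    have "type_points \<tau> n N \<pi> \<noteq> {}" if "\<pi> \<in> S" for \<pi>
    proof -
      have "card (type_points \<tau> n N \<pi>) > 0" using eq that by (simp add: S_def)
      then show ?thesis by (metis card.empty less_irrefl)
    qed
    moreover have "sat n N s \<chi>" for s
      by (rule sat\<chi>[THEN spec, THEN spec, THEN spec, THEN mp, OF eq])
    ultimately show "true_in n N \<phi>"
      by (simp add: true_in_def sat\<phi>[rule_format])
  next
    assume "true_in n N \<phi>"
    \<comment> \<open>Truth is a statement about all assignments into the domain;
      \<open>n \<ge> 1\<close> provides one.\<close>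
    then have sat: "sat n N (\<lambda>_. 1) \<phi>" using n by (simp add: true_in_def image_subset_iff)
    then have real: "\<forall>\<pi>\<in>Pow \<tau>. k \<pi> > 0 \<longrightarrow> type_points \<tau> n N \<pi> \<noteq> {}"
      by (simp add: sat\<phi>[rule_format] S_def)
    have "sat n N (\<lambda>_. 1) \<chi>" using sat by (simp add: sat\<phi>[rule_format])
    then have le: "k \<pi> \<le> card (type_points \<tau> n N \<pi>)" if "\<pi> \<in> Pow \<tau>" for \<pi>
      using \<chi>_imp[THEN spec, THEN spec, THEN spec, THEN mp, THEN mp, OF _ real] that by blast
    \<comment> \<open>Both families of class sizes add up to \<open>n\<close>, so the lower bounds
      are equalities.\<close>
    have "k \<pi> = card (type_points \<tau> n N \<pi>)" if "\<pi> \<in> Pow \<tau>" for \<pi>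
      by (rule sum_le_imp_eq[OF _ le _ that])
        (simp_all add: fin k_def sum_card_type_points[OF fin])
    then show "isomorphic \<tau> n M N"
      by (simp add: isomorphic_iff_card_type_points k_def)
  qed
  then have "describes \<tau> n \<phi> M" using sentence by (simp add: describes_def)
  moreover have "fo_size \<phi> \<le> 3 * (m - 1) + (4 * card \<tau> + 5) * 2 ^ card \<tau> + 8 * card \<tau> + 5"
  proof -
    have "card S \<le> 2 ^ card \<tau>"
      using card_mono[OF _ S(2)] fin by (simp add: card_Pow)
    then have "(2 * card \<tau> + 3) * card S \<le> (2 * card \<tau> + 3) * 2 ^ card \<tau>"
      by (rule mult_le_mono2)
    moreover have "(4 * card \<tau> + 5) * 2 ^ card \<tau> =
        (2 * card \<tau> + 2) * 2 ^ card \<tau> + (2 * card \<tau> + 3) * 2 ^ card \<tau>"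
      by (simp add: algebra_simps)
    ultimately show ?thesis using \<phi>(1) \<chi>(1) by linarith
  qed
  ultimately show ?thesis by blast
qed

subsection \<open>Small formulas do not see large types\<close>

fun quants :: "'r fo \<Rightarrow> nat" where
  "quants (Conj \<phi> \<psi>) = quants \<phi> + quants \<psi>"
| "quants (Disj \<phi> \<psi>) = quants \<phi> + quants \<psi>"
| "quants (Exi x \<phi>) = Suc (quants \<phi>)"
| "quants (Uni x \<phi>) = Suc (quants \<phi>)"
| "quants _ = 0"

fun atoms :: "'r fo \<Rightarrow> nat" where
  "atoms (Conj \<phi> \<psi>) = atoms \<phi> + atoms \<psi>"
| "atoms (Disj \<phi> \<psi>) = atoms \<phi> + atoms \<psi>"
| "atoms (Exi x \<phi>) = atoms \<phi>"
| "atoms (Uni x \<phi>) = atoms \<phi>"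
| "atoms _ = 1"

text \<open>The binary connectives number one fewer than the atoms they join.\<close>

lemma fo_size_eq: "fo_size \<phi> + 1 = quants \<phi> + 2 * atoms \<phi>"
  by (induction \<phi>) auto

text \<open>The quantifier occurrences of a formula are numbered consecutively from \<open>c\<close> on, and \<open>e\<close>
  maps each variable in scope to the occurrence that binds it. Every equality atom is an edge
  between two occurrences.\<close>

fun edges :: "(nat \<Rightarrow> nat) \<Rightarrow> nat \<Rightarrow> 'r fo \<Rightarrow> (nat \<times> nat) set" where
  "edges e c (Eq x y) = {(e x, e y)}"
| "edges e c (NEq x y) = {(e x, e y)}"
| "edges e c (Conj \<phi> \<psi>) = edges e c \<phi> \<union> edges e (c + quants \<phi>) \<psi>"
| "edges e c (Disj \<phi> \<psi>) = edges e c \<phi> \<union> edges e (c + quants \<phi>) \<psi>"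
| "edges e c (Exi x \<phi>) = edges (e(x := c)) (Suc c) \<phi>"
| "edges e c (Uni x \<phi>) = edges (e(x := c)) (Suc c) \<phi>"
| "edges e c _ = {}"

lemma finite_edges [simp]: "finite (edges e c \<phi>)"
  by (induction \<phi> arbitrary: e c) auto

lemma card_edges_le: "card (edges e c \<phi>) \<le> atoms \<phi>"
proof (induction \<phi> arbitrary: e c)
  case (Conj \<phi> \<psi>)
  show ?case
    using card_Un_le[of "edges e c \<phi>" "edges e (c + quants \<phi>) \<psi>"]
      Conj.IH(1)[of e c] Conj.IH(2)[of e "c + quants \<phi>"] by simp
next
  case (Disj \<phi> \<psi>)
  show ?case
    using card_Un_le[of "edges e c \<phi>" "edges e (c + quants \<phi>) \<psi>"]
      Disj.IH(1)[of e c] Disj.IH(2)[of e "c + quants \<phi>"] by simp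
qed simp_all

text \<open>The labels are the connected components. For a set \<open>X\<close> inside one component, the bound says
  that a component with \<open>v\<close> vertices needs at least \<open>v - 1\<close> edges.\<close>

lemma ex_component_labelling:
  assumes "finite E"
  shows "\<exists>f :: 'a \<Rightarrow> 'a. (\<forall>(x, y)\<in>E. f x = f y) \<and>
    (\<forall>X. finite X \<longrightarrow> card X \<le> card E + card (f ` X))"
  using assms
proof induction
  case empty
  show ?case by (rule exI[of _ id]) simp
next
  case (insert z E)
  obtain a b where z: "z = (a, b)" by fastforce
  obtain f :: "'a \<Rightarrow> 'a" where f: "\<forall>(x, y)\<in>E. f x = f y"
    and card: "\<And>X. finite X \<Longrightarrow> card X \<le> card E + card (f ` X)"
    using insert.IH by blast
  \<comment> \<open>The component of \<open>b\<close> is merged into that of \<open>a\<close>. Only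
    the label \<open>f b\<close> can disappear, so a new edge costs at most one label.\<close>
  define f' where "f' x = (if f x = f b then f a else f x)" for x
  have "\<forall>(x, y)\<in>insert z E. f' x = f' y" using f by (auto simp: f'_def z)
  moreover have "card X \<le> card (insert z E) + card (f' ` X)" if "finite X" for X
  proof -
    have "card (f ` X) \<le> card (insert (f b) (f' ` X))"
      by (rule card_mono) (use that in \<open>auto simp: f'_def\<close>)
    also have "\<dots> \<le> Suc (card (f' ` X))" by (rule card_insert_le_m1) simp_all
    finally show ?thesis using card[OF that] insert.hyps by simp
  qed
  ultimately show ?case by (intro exI[of _ f']) simp
qed

text \<open>Values are compared only within a component, so at most as many points as a component
  has vertices are ever tracked at the same time.\<close>

definition matching ::
  "'r set \<Rightarrow> nat \<Rightarrow> (nat \<Rightarrow> 'c) \<Rightarrow> nat set \<Rightarrow> 'r interp \<Rightarrow> (nat \<Rightarrow> nat) \<Rightarrow> 'r interp \<Rightarrow> (nat \<Rightarrow> nat) \<Rightarrow> bool"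
  where
  "matching \<tau> n f A M v N v' \<longleftrightarrow>
     (\<forall>i\<in>A. v i \<in> {1..n} \<and> v' i \<in> {1..n} \<and> type_of \<tau> M (v i) = type_of \<tau> N (v' i)) \<and>
     (\<forall>i\<in>A. \<forall>j\<in>A. f i = f j \<longrightarrow> (v i = v j \<longleftrightarrow> v' i = v' j))"

lemma matching_sym: "matching \<tau> n f A M v N v' \<Longrightarrow> matching \<tau> n f A N v' M v"
  by (simp add: matching_def)

section \<open>Back-and-forth along components\<close>

text \<open>The usual invariant for Ehrenfeucht-Fraisse games on unary models, with \<open>K\<close>
  bounding the vertices of a component instead of the moves of the whole game.\<close>

definition similar :: "'r set \<Rightarrow> nat \<Rightarrow> nat \<Rightarrow> 'r interp \<Rightarrow> 'r interp \<Rightarrow> bool" where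
  "similar \<tau> n K M N \<longleftrightarrow> (\<forall>\<pi>\<in>Pow \<tau>.
     min K (card (type_points \<tau> n M \<pi>)) = min K (card (type_points \<tau> n N \<pi>)))"

lemma similar_sym: "similar \<tau> n K M N \<Longrightarrow> similar \<tau> n K N M"
  by (simp add: similar_def)

text \<open>On \<open>T\<close> the map \<open>w\<close> factors through \<open>v\<close>.\<close>

lemma card_image_le_card_image:
  assumes "finite T" "\<And>i j. i \<in> T \<Longrightarrow> j \<in> T \<Longrightarrow> v i = v j \<Longrightarrow> w i = w j"
  shows "card (w ` T) \<le> card (v ` T)"
proof -
  have "w (inv_into T v (v i)) = w i" if "i \<in> T" for i
    by (rule assms(2)) (use that in \<open>simp_all add: inv_into_into f_inv_into_f\<close>)
  then have "w ` T = (\<lambda>z. w (inv_into T v z)) ` v ` T"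
    unfolding image_image by (intro image_cong) simp_all
  then show ?thesis using assms(1) by (metis card_image_le finite_imageI)
qed

text \<open>Only the earlier vertices \<open>D\<close> in the component of \<open>c\<close> restrict
  the answer. An old value is answered by its partner. For a new value, suppose \<open>D\<close>
  used up its type in \<open>N\<close>. That class would then have fewer than \<open>K\<close>
  points and fewer points than the class in \<open>M\<close>, which contains in addition the new
  point \<open>a\<close>; similarity forbids this.\<close>

lemma matching_extend:
  assumes match: "matching \<tau> n f A M v N v'" and sim: "similar \<tau> n K M N"
    and small: "\<And>l. card {i \<in> {..<Q}. f i = l} \<le> K" and A: "A \<subseteq> {..<c}" and c: "c < Q" and a: "a \<in> {1..n}"
  obtains a' where "a' \<in> {1..n}" "matching \<tau> n f (insert c A) M (v(c := a)) N (v'(c := a'))"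
proof -
  have dom: "v i \<in> {1..n}" "v' i \<in> {1..n}" "type_of \<tau> M (v i) = type_of \<tau> N (v' i)" if "i \<in> A" for i
    using match that by (auto simp: matching_def)
  have eq: "v i = v j \<longleftrightarrow> v' i = v' j" if "i \<in> A" "j \<in> A" "f i = f j" for i j
    using match that by (simp add: matching_def)
  define D where "D = {i \<in> A. f i = f c}"
  have D: "i \<in> D \<longleftrightarrow> i \<in> A \<and> f i = f c" for i by (simp add: D_def)
  have finA: "finite A" and cA: "c \<notin> A" using A finite_subset by auto
  have "\<exists>a'\<in>{1..n}. type_of \<tau> N a' = type_of \<tau> M a \<and> (\<forall>i\<in>D. v i = a \<longleftrightarrow> v' i = a')"
  proof (cases "a \<in> v ` D")
    case True
    then obtain j where j: "j \<in> D" "a = v j" by blast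
    then show ?thesis
      using dom[of j] eq[of _ j] by (intro bexI[of _ "v' j"]) (simp_all add: D)
  next
    case False
    define \<pi> where "\<pi> = type_of \<tau> M a"
    have \<pi>: "\<pi> \<subseteq> \<tau>" by (simp add: \<pi>_def type_of_subset)
    define T where "T = {i \<in> D. type_of \<tau> M (v i) = \<pi>}"
    have T: "finite T" "T \<subseteq> D" using finA by (auto simp: T_def D_def)
    have "\<not> type_points \<tau> n N \<pi> \<subseteq> v' ` D"
    proof
      assume sub: "type_points \<tau> n N \<pi> \<subseteq> v' ` D"
      have "type_points \<tau> n N \<pi> \<subseteq> v' ` T"
      proof
        fix b assume b: "b \<in> type_points \<tau> n N \<pi>"
        then obtain i where "i \<in> D" "b = v' i" using sub by blast
        then show "b \<in> v' ` T" using b dom[of i] by (simp add: T_def D mem_type_points[OF \<pi>])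
      qed
      then have *: "card (type_points \<tau> n N \<pi>) \<le> card (v' ` T)"
        using T by (intro card_mono) simp_all
      have "card (v' ` T) \<le> card T" using T by (intro card_image_le)
      also have "\<dots> \<le> card D" using T by (intro card_mono) (simp_all add: D_def finA)
      \<comment> \<open>The vertex \<open>c\<close> itself belongs to the component, which makes the
        bound by \<open>K\<close> strict.\<close>
      also have "\<dots> < card (insert c D)" by (simp add: D_def finA cA)
      also have "\<dots> \<le> card {i \<in> {..<Q}. f i = f c}"
        by (rule card_mono) (use c A in \<open>auto simp: D_def\<close>)
      also have "\<dots> \<le> K" by (rule small)
      finally have "card (v' ` T) < K" .
      moreover have "card (v' ` T) < card (type_points \<tau> n M \<pi>)"
      proof -
        have "card (v' ` T) \<le> card (v ` T)"
          by (rule card_image_le_card_image[OF T(1)]) (use eq in \<open>simp add: T_def D\<close>)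
        also have "\<dots> < card (type_points \<tau> n M \<pi>)"
        proof (rule psubset_card_mono)
          have "v ` T \<subseteq> type_points \<tau> n M \<pi>"
            by (rule image_subsetI) (use dom(1) in \<open>simp add: T_def D mem_type_points[OF \<pi>]\<close>)
          moreover have "a \<in> type_points \<tau> n M \<pi>"
            using a by (simp add: mem_type_points \<pi>_def type_of_subset)
          moreover have "a \<notin> v ` T" using False T(2) by blast
          ultimately show "v ` T \<subset> type_points \<tau> n M \<pi>" by blast
        qed simp
        finally show ?thesis .
      qed
      moreover have "min K (card (type_points \<tau> n M \<pi>)) = min K (card (type_points \<tau> n N \<pi>))"
        using sim \<pi> by (simp add: similar_def)
      ultimately show False using * by linarith
    qed
    then obtain a' where a': "a' \<in> type_points \<tau> n N \<pi>" "a' \<notin> v' ` D" by blast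
    then have "a' \<in> {1..n}" "type_of \<tau> N a' = \<pi>" by (simp_all add: mem_type_points[OF \<pi>])
    then show ?thesis using False a'(2) by (intro bexI[of _ a']) (auto simp: \<pi>_def)
  qed
  then obtain a' where a': "a' \<in> {1..n}" "type_of \<tau> N a' = type_of \<tau> M a"
    and iff: "\<And>i. i \<in> D \<Longrightarrow> v i = a \<longleftrightarrow> v' i = a'" by blast
  have "matching \<tau> n f (insert c A) M (v(c := a)) N (v'(c := a'))"
    unfolding matching_def
  proof (intro conjI ballI impI)
    fix i j assume ij: "i \<in> insert c A" "j \<in> insert c A" "f i = f j"
    then show "(v(c := a)) i = (v(c := a)) j \<longleftrightarrow> (v'(c := a')) i = (v'(c := a')) j"
      using eq[of i j] iff[of i] iff[of j] cA by (auto simp: D)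
  qed (use a a' dom in auto)
  then show ?thesis using that a'(1) by blast
qed

text \<open>Assignments are kept in the form \<open>v \<circ> e\<close>. Binding \<open>x\<close>
  overwrites the value at vertex \<open>c\<close> and lets \<open>x\<close> name it; the other free
  variables name vertices in \<open>A\<close>, hence not \<open>c\<close>.\<close>

lemma sat_shift:
  assumes "\<forall>y\<in>free_vars \<phi> - {x}. e y \<in> A" "c \<notin> A"
  shows "sat n M ((v \<circ> e)(x := a)) \<phi> = sat n M (v(c := a) \<circ> e(x := c)) \<phi>"
proof (rule sat_cong)
  fix y assume "y \<in> free_vars \<phi>"
  then have "e y \<noteq> c" if "y \<noteq> x" using that assms by blast
  then show "((v \<circ> e)(x := a)) y = (v(c := a) \<circ> e(x := c)) y" by simp
qed

text \<open>Relation atoms see only types, and an equality atom compares vertices of one component,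
  where \<open>matching\<close> preserves equality. Quantifiers are handled by
  \<open>matching_extend\<close> in both directions, as \<open>matching\<close> and
  \<open>similar\<close> are symmetric. The bound \<open>Q\<close> keeps every new vertex among
  those counted in the components.\<close>

lemma sat_transfer:
  assumes sim: "similar \<tau> n K M N" and small: "\<And>l. card {i \<in> {..<Q}. f i = l} \<le> K"
    and "matching \<tau> n f A M v N v'" and "A \<subseteq> {..<c}" and "symbols \<phi> \<subseteq> \<tau>"
    and "\<forall>(i, j)\<in>edges e c \<phi>. f i = f j"
    and "c + quants \<phi> \<le> Q" and "\<forall>x\<in>free_vars \<phi>. e x \<in> A"
  shows "sat n M (v \<circ> e) \<phi> \<longleftrightarrow> sat n N (v' \<circ> e) \<phi>"
  using assms(3-)
proof (induction \<phi> arbitrary: e A c v v')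
  case (Rel P x)
  then have "type_of \<tau> M (v (e x)) = type_of \<tau> N (v' (e x))" by (simp add: matching_def)
  then show ?case using Rel.prems(3) by (auto simp: type_of_def)
next
  case (NRel P x)
  then have "type_of \<tau> M (v (e x)) = type_of \<tau> N (v' (e x))" by (simp add: matching_def)
  then show ?case using NRel.prems(3) by (auto simp: type_of_def)
next
  case (Eq x y)
  then show ?case by (simp add: matching_def)
next
  case (NEq x y)
  then show ?case by (simp add: matching_def)
next
  case (Conj \<phi> \<psi>)
  \<comment> \<open>The second conjunct numbers its quantifiers after those of the first, so the
    vertices in scope still lie below its starting number.\<close>
  have A: "A \<subseteq> {..<c + quants \<phi>}" using Conj.prems(2) by auto
  have "sat n M (v \<circ> e) \<phi> \<longleftrightarrow> sat n N (v' \<circ> e) \<phi>"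
    by (rule Conj.IH(1)[OF Conj.prems(1,2)]) (use Conj.prems(3-) in simp_all)
  moreover have "sat n M (v \<circ> e) \<psi> \<longleftrightarrow> sat n N (v' \<circ> e) \<psi>"
    by (rule Conj.IH(2)[OF Conj.prems(1) A]) (use Conj.prems(3-) in simp_all)
  ultimately show ?case by (simp only: sat.simps)
next
  case (Disj \<phi> \<psi>)
  have A: "A \<subseteq> {..<c + quants \<phi>}" using Disj.prems(2) by auto
  have "sat n M (v \<circ> e) \<phi> \<longleftrightarrow> sat n N (v' \<circ> e) \<phi>"
    by (rule Disj.IH(1)[OF Disj.prems(1,2)]) (use Disj.prems(3-) in simp_all)
  moreover have "sat n M (v \<circ> e) \<psi> \<longleftrightarrow> sat n N (v' \<circ> e) \<psi>"
    by (rule Disj.IH(2)[OF Disj.prems(1) A]) (use Disj.prems(3-) in simp_all)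
  ultimately show ?case by (simp only: sat.simps)
next
  case (Exi x \<phi>)
  have c: "c < Q" "c \<notin> A" using Exi.prems(2,5) by auto
  have step: "sat n M ((v \<circ> e)(x := a)) \<phi> \<longleftrightarrow> sat n N ((v' \<circ> e)(x := a')) \<phi>"
    if "matching \<tau> n f (insert c A) M (v(c := a)) N (v'(c := a'))" for a a'
  proof -
    have "\<forall>y\<in>free_vars \<phi> - {x}. e y \<in> A" using Exi.prems(6) by simp
    moreover have "sat n M (v(c := a) \<circ> e(x := c)) \<phi> \<longleftrightarrow> sat n N (v'(c := a') \<circ> e(x := c)) \<phi>"
    proof (rule Exi.IH[OF that, where c = "Suc c"])
      show "insert c A \<subseteq> {..<Suc c}" using Exi.prems(2) by auto
      show "\<forall>y\<in>free_vars \<phi>. (e(x := c)) y \<in> insert c A" using Exi.prems(6) by auto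
    qed (use Exi.prems(3-5) in \<open>simp_all del: fun_upd_apply\<close>)
    ultimately show ?thesis using sat_shift c(2) by metis
  qed
  show ?case
  proof
    assume "sat n M (v \<circ> e) (Exi x \<phi>)"
    then obtain a where a: "a \<in> {1..n}" "sat n M ((v \<circ> e)(x := a)) \<phi>" by (auto simp only: sat.simps)
    obtain a' where "a' \<in> {1..n}" "matching \<tau> n f (insert c A) M (v(c := a)) N (v'(c := a'))"
      by (rule matching_extend[OF Exi.prems(1) sim small Exi.prems(2) c(1) a(1)])
    then show "sat n N (v' \<circ> e) (Exi x \<phi>)" using a(2) step by (auto simp only: sat.simps)
  next
    assume "sat n N (v' \<circ> e) (Exi x \<phi>)"
    then obtain a' where a': "a' \<in> {1..n}" "sat n N ((v' \<circ> e)(x := a')) \<phi>" by (auto simp only: sat.simps)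
    obtain a where "a \<in> {1..n}" "matching \<tau> n f (insert c A) N (v'(c := a')) M (v(c := a))"
      by (rule matching_extend[OF matching_sym[OF Exi.prems(1)] similar_sym[OF sim] small
            Exi.prems(2) c(1) a'(1)])
    then show "sat n M (v \<circ> e) (Exi x \<phi>)" using a'(2) step[OF matching_sym] by (auto simp only: sat.simps)
  qed
next
  case (Uni x \<phi>)
  have c: "c < Q" "c \<notin> A" using Uni.prems(2,5) by auto
  have step: "sat n M ((v \<circ> e)(x := a)) \<phi> \<longleftrightarrow> sat n N ((v' \<circ> e)(x := a')) \<phi>"
    if "matching \<tau> n f (insert c A) M (v(c := a)) N (v'(c := a'))" for a a'
  proof -
    have "\<forall>y\<in>free_vars \<phi> - {x}. e y \<in> A" using Uni.prems(6) by simp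
    moreover have "sat n M (v(c := a) \<circ> e(x := c)) \<phi> \<longleftrightarrow> sat n N (v'(c := a') \<circ> e(x := c)) \<phi>"
    proof (rule Uni.IH[OF that, where c = "Suc c"])
      show "insert c A \<subseteq> {..<Suc c}" using Uni.prems(2) by auto
      show "\<forall>y\<in>free_vars \<phi>. (e(x := c)) y \<in> insert c A" using Uni.prems(6) by auto
    qed (use Uni.prems(3-5) in \<open>simp_all del: fun_upd_apply\<close>)
    ultimately show ?thesis using sat_shift c(2) by metis
  qed
  show ?case
  proof
    assume M: "sat n M (v \<circ> e) (Uni x \<phi>)"
    have "sat n N ((v' \<circ> e)(x := a')) \<phi>" if a': "a' \<in> {1..n}" for a'
    proof -
      obtain a where "a \<in> {1..n}" "matching \<tau> n f (insert c A) N (v'(c := a')) M (v(c := a))"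
        by (rule matching_extend[OF matching_sym[OF Uni.prems(1)] similar_sym[OF sim] small
              Uni.prems(2) c(1) a'])
      then show ?thesis using M step[OF matching_sym] by (auto simp only: sat.simps)
    qed
    then show "sat n N (v' \<circ> e) (Uni x \<phi>)" by (simp only: sat.simps) blast
  next
    assume N: "sat n N (v' \<circ> e) (Uni x \<phi>)"
    have "sat n M ((v \<circ> e)(x := a)) \<phi>" if a: "a \<in> {1..n}" for a
    proof -
      obtain a' where "a' \<in> {1..n}" "matching \<tau> n f (insert c A) M (v(c := a)) N (v'(c := a'))"
        by (rule matching_extend[OF Uni.prems(1) sim small Uni.prems(2) c(1) a])
      then show ?thesis using N step by (auto simp only: sat.simps)
    qed
    then show "sat n M (v \<circ> e) (Uni x \<phi>)" by (simp only: sat.simps) blast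
  qed
qed

section \<open>From small size to small components\<close>

text \<open>A component has at most \<open>quants \<phi>\<close> vertices and, being joined by at
  most \<open>atoms \<phi>\<close> edges, at most \<open>atoms \<phi> + 1\<close>. If both numbers
  exceeded \<open>K\<close>, the size would be at least (K + 1) + 2 K - 1 = 3 K.\<close>

lemma sat_similar_models:
  assumes sentence: "is_sentence \<tau> \<phi>" and small: "fo_size \<phi> < 3 * K" and sim: "similar \<tau> n K M N"
  shows "sat n M s \<phi> \<longleftrightarrow> sat n N s \<phi>"
proof -
  have free: "free_vars \<phi> = {}" and symb: "symbols \<phi> \<subseteq> \<tau>"
    using sentence by (simp_all add: is_sentence_def)
  obtain f :: "nat \<Rightarrow> nat" where f: "\<forall>(i, j)\<in>edges id 0 \<phi>. f i = f j"
    and card: "\<And>X. finite X \<Longrightarrow> card X \<le> card (edges id 0 \<phi>) + card (f ` X)"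
    using ex_component_labelling[OF finite_edges[of id 0 \<phi>]] by blast
  have component: "card {i \<in> {..<quants \<phi>}. f i = l} \<le> K" for l
  proof -
    define X where "X = {i \<in> {..<quants \<phi>}. f i = l}"
    have "card X \<le> card {..<quants \<phi>}" by (rule card_mono) (auto simp: X_def)
    then have "card X \<le> quants \<phi>" by simp
    moreover have "card X \<le> atoms \<phi> + 1"
    proof -
      have "f ` X \<subseteq> {l}" by (auto simp: X_def)
      then have "card (f ` X) \<le> card {l}" by (rule card_mono[rotated]) simp
      then show ?thesis using card[of X] card_edges_le[of id 0 \<phi>] by (simp add: X_def)
    qed
    ultimately have "card X \<le> K" using small fo_size_eq[of \<phi>] by linarith
    then show ?thesis by (simp add: X_def)
  qed
  \<comment> \<open>A sentence has no variable in scope at the start, so the empty matching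
    suffices.\<close>
  have "sat n M (s \<circ> id) \<phi> \<longleftrightarrow> sat n N (s \<circ> id) \<phi>"
    by (rule sat_transfer[OF sim component, where A = "{}" and c = 0])
      (use f free symb in \<open>simp_all add: matching_def\<close>)
  then show ?thesis by simp
qed

lemma fo_size_ge_if_describes:
  assumes describes: "describes \<tau> n \<phi> M" and model: "is_model \<tau> n M"
    and \<pi>: "\<pi>\<^sub>1 \<subseteq> \<tau>" "\<pi>\<^sub>2 \<subseteq> \<tau>" "\<pi>\<^sub>1 \<noteq> \<pi>\<^sub>2"
    and k: "Suc k \<le> card (type_points \<tau> n M \<pi>\<^sub>1)" "Suc k \<le> card (type_points \<tau> n M \<pi>\<^sub>2)"
  shows "3 * k \<le> fo_size \<phi>"
proof (rule ccontr)
  assume "\<not> ?thesis"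
  then have small: "fo_size \<phi> < 3 * k" by simp
  obtain b where b: "b \<in> type_points \<tau> n M \<pi>\<^sub>1" using k(1) by fastforce
  then have b': "b \<in> {1..n}" "type_of \<tau> M b = \<pi>\<^sub>1" by (simp_all add: mem_type_points \<pi>(1,2))
  define N where "N P = (if P \<in> \<pi>\<^sub>2 then insert b (M P) else M P - {b})" for P
  have N: "is_model \<tau> n N" using model b' by (auto simp: is_model_def N_def)
  have type_N: "type_of \<tau> N a = (if a = b then \<pi>\<^sub>2 else type_of \<tau> M a)" for a
    using \<pi>(2) by (auto simp: type_of_def N_def)
  have tp1: "type_points \<tau> n N \<pi>\<^sub>1 = type_points \<tau> n M \<pi>\<^sub>1 - {b}"
    using \<pi>(3) by (auto simp: mem_type_points \<pi>(1,2) type_N split: if_splits)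
  have tp2: "type_points \<tau> n N \<pi>\<^sub>2 = insert b (type_points \<tau> n M \<pi>\<^sub>2)"
    using b' by (auto simp: mem_type_points \<pi>(1,2) type_N split: if_splits)
  have tp: "type_points \<tau> n N \<pi> = type_points \<tau> n M \<pi>"
    if "\<pi> \<subseteq> \<tau>" "\<pi> \<noteq> \<pi>\<^sub>1" "\<pi> \<noteq> \<pi>\<^sub>2" for \<pi>
    using that b' by (auto simp: mem_type_points type_N split: if_splits)
  have card1: "card (type_points \<tau> n N \<pi>\<^sub>1) = card (type_points \<tau> n M \<pi>\<^sub>1) - 1"
    by (simp add: tp1 b card_Diff_singleton)
  have card2: "card (type_points \<tau> n N \<pi>\<^sub>2) \<ge> card (type_points \<tau> n M \<pi>\<^sub>2)"
    unfolding tp2 by (rule card_mono) auto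
  \<comment> \<open>The class that loses \<open>b\<close> keeps at least \<open>k\<close> points,
    thanks to \<open>Suc k\<close>; the other one only grows from a size that is already above
    \<open>k\<close>.\<close>
  have "similar \<tau> n k M N"
    unfolding similar_def
  proof
    fix \<pi> assume "\<pi> \<in> Pow \<tau>"
    then consider "\<pi> = \<pi>\<^sub>1" | "\<pi> = \<pi>\<^sub>2" | "type_points \<tau> n N \<pi> = type_points \<tau> n M \<pi>"
      using tp by blast
    then show "min k (card (type_points \<tau> n M \<pi>)) = min k (card (type_points \<tau> n N \<pi>))"
      using k card1 card2 by cases auto
  qed
  moreover have "is_sentence \<tau> \<phi>" using describes by (simp add: describes_def)
  ultimately have sat: "sat n M s \<phi> \<longleftrightarrow> sat n N s \<phi>" for s
    using small sat_similar_models by blast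
  have "\<not> isomorphic \<tau> n M N"
  proof
    assume "isomorphic \<tau> n M N"
    then have "card (type_points \<tau> n M \<pi>\<^sub>1) = card (type_points \<tau> n N \<pi>\<^sub>1)"
      using \<pi>(1) by (simp add: isomorphic_iff_card_type_points)
    then show False using card1 k(1) by linarith
  qed
  moreover have "isomorphic \<tau> n M M" by (simp add: isomorphic_iff_card_type_points)
  ultimately have "true_in n M \<phi>" "\<not> true_in n N \<phi>"
    using describes model N by (simp_all add: describes_def)
  then show False using sat by (simp add: true_in_def)
qed

subsection \<open>The two bounds\<close>

theorem theorem7:
  fixes \<tau> :: "'r set" and n :: nat and M :: "'r interp" and t c\<^sub>\<tau> p :: real
  assumes "finite \<tau>"
    and "t = 2 ^ card \<tau>"
    and "c\<^sub>\<tau> = 15 * real (card \<tau>) * 2 ^ card \<tau>"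
    and "n \<ge> 1"
    and "is_model \<tau> n M"
    and "p \<in> {0..<1 / t}"
    and "entropy_S \<tau> n M
           > ((t - 1) * p - 1) * log 2 (1 - (t - 1) * p) - (t - 1) * p * log 2 p"
  shows "3 * real n * p - 3 < real (descr_complexity \<tau> n M)
       \<and> real (descr_complexity \<tau> n M) < 3 * real n * (1 - (t - 1) * p) + c\<^sub>\<tau>"
proof -
  note fin = assms(1) and n = assms(4)
  define k where "k \<pi> = card (type_points \<tau> n M \<pi>)" for \<pi>
  have less: "real (k \<pi>) < real n * (1 - (t - 1) * p)" if "\<pi> \<subseteq> \<tau>" for \<pi>
    unfolding k_def using that by (rule card_type_points_less_if_entropy[OF fin assms(2,4,6,7)])
  have sum: "sum k (Pow \<tau>) = n" by (simp add: k_def sum_card_type_points[OF fin])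
  \<comment> \<open>The constant \<open>c\<^sub>\<tau>\<close> is 0 for the empty vocabulary, so it
    could not absorb any overhead. There the only type would contain all \<open>n\<close> points,
    against the cap.\<close>
  have "\<tau> \<noteq> {}"
  proof
    assume "\<tau> = {}"
    then have "k {} = n" "t = 1" using sum assms(2) by simp_all
    then show False using less[of "{}"] by simp
  qed
  then have card: "card \<tau> \<ge> 1" using fin by (simp add: Suc_le_eq card_gt_0_iff)
  obtain \<pi>\<^sub>0 where \<pi>\<^sub>0: "\<pi>\<^sub>0 \<subseteq> \<tau>" and max: "\<And>\<pi>. \<pi> \<subseteq> \<tau> \<Longrightarrow> k \<pi> \<le> k \<pi>\<^sub>0"
  proof -
    have "Max (k ` Pow \<tau>) \<in> k ` Pow \<tau>" by (rule Max_in) (use fin in auto)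
    then obtain \<pi>\<^sub>0 where "\<pi>\<^sub>0 \<in> Pow \<tau>" "Max (k ` Pow \<tau>) = k \<pi>\<^sub>0" by blast
    moreover have "k \<pi> \<le> Max (k ` Pow \<tau>)" if "\<pi> \<subseteq> \<tau>" for \<pi>
      by (rule Max_ge) (use fin that in auto)
    ultimately show thesis using that by auto
  qed
  \<comment> \<open>This makes \<open>k \<pi>\<^sub>0 - 1\<close> save a full 3 in the size. For a
    single symbol the overhead is 31, just above the 30 allowed by
    \<open>c\<^sub>\<tau>\<close>.\<close>
  have pos: "k \<pi>\<^sub>0 \<ge> 1"
  proof (rule ccontr)
    assume "\<not> ?thesis"
    then have "k \<pi> = 0" if "\<pi> \<in> Pow \<tau>" for \<pi> using max[of \<pi>] that by simp
    then have "sum k (Pow \<tau>) = 0" by simp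
    then show False using sum n by simp
  qed
  have "\<exists>\<phi>. describes \<tau> n \<phi> M \<and>
      fo_size \<phi> \<le> 3 * (k \<pi>\<^sub>0 - 1) + (4 * card \<tau> + 5) * 2 ^ card \<tau> + 8 * card \<tau> + 5"
    by (rule ex_describing_formula[OF fin n]) (use max in \<open>simp add: k_def\<close>)
  then obtain \<phi> where \<phi>: "describes \<tau> n \<phi> M"
    and size: "fo_size \<phi> \<le> 3 * (k \<pi>\<^sub>0 - 1) + (4 * card \<tau> + 5) * 2 ^ card \<tau> + 8 * card \<tau> + 5"
    by blast
  have "\<exists>\<psi>. describes \<tau> n \<psi> M \<and> fo_size \<psi> = descr_complexity \<tau> n M"
    unfolding descr_complexity_def
    by (rule LeastI[where P = "\<lambda>k. \<exists>\<psi>. describes \<tau> n \<psi> M \<and> fo_size \<psi> = k"]) (use \<phi> in blast)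
  then obtain \<psi> where \<psi>: "describes \<tau> n \<psi> M" "fo_size \<psi> = descr_complexity \<tau> n M" by blast

  have "descr_complexity \<tau> n M \<le> fo_size \<phi>"
    unfolding descr_complexity_def by (rule Least_le) (use \<phi> in blast)
  also have "fo_size \<phi> \<le> 3 * k \<pi>\<^sub>0 + 15 * card \<tau> * 2 ^ card \<tau>"
  proof -
    \<comment> \<open>Put C = \<open>card \<tau> * T\<close>. Since \<open>T\<close> and
      \<open>2 * card \<tau>\<close> are at most C, the overhead is at most 13 C + 5 - 3, which is
      below 15 C.\<close>
    define T :: nat where "T = 2 ^ card \<tau>"
    have "2 ^ 1 \<le> T" unfolding T_def using card by (intro power_increasing) auto
    then have "card \<tau> * 2 \<le> card \<tau> * T" by simp
    moreover have "T \<le> card \<tau> * T" using card by simp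
    moreover have "(4 * card \<tau> + 5) * T = 4 * (card \<tau> * T) + 5 * T" by (simp add: algebra_simps)
    moreover have "15 * card \<tau> * T = 15 * (card \<tau> * T)" by simp
    ultimately show ?thesis using size pos card unfolding T_def[symmetric] by linarith
  qed
  finally have "real (descr_complexity \<tau> n M) \<le> real (3 * k \<pi>\<^sub>0 + 15 * card \<tau> * 2 ^ card \<tau>)"
    by (simp only: of_nat_le_iff)
  then have upper: "real (descr_complexity \<tau> n M) < 3 * real n * (1 - (t - 1) * p) + c\<^sub>\<tau>"
    using less[OF \<pi>\<^sub>0] assms(3) by simp

  have "\<exists>\<pi>. \<pi> \<subseteq> \<tau> \<and> \<pi> \<noteq> \<pi>\<^sub>0 \<and> real n * p < real (k \<pi>)"
  proof (rule ccontr)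
    assume neg: "\<not> ?thesis"
    have le: "real (k \<pi>) \<le> real n * p" if "\<pi> \<in> Pow \<tau> - {\<pi>\<^sub>0}" for \<pi>
    proof (rule leI)
      show "\<not> real n * p < real (k \<pi>)" using neg that by blast
    qed
    have "sum k (Pow \<tau>) = k \<pi>\<^sub>0 + sum k (Pow \<tau> - {\<pi>\<^sub>0})"
      by (rule sum.remove) (use fin \<pi>\<^sub>0 in simp_all)
    then have "real n = real (k \<pi>\<^sub>0) + (\<Sum>\<pi>\<in>Pow \<tau> - {\<pi>\<^sub>0}. real (k \<pi>))"
      by (simp add: sum)
    moreover have "(\<Sum>\<pi>\<in>Pow \<tau> - {\<pi>\<^sub>0}. real (k \<pi>)) \<le> real (card (Pow \<tau> - {\<pi>\<^sub>0})) * (real n * p)"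
      by (rule sum_bounded_above[OF le])
    moreover have "real (card (Pow \<tau> - {\<pi>\<^sub>0})) = t - 1"
      using fin \<pi>\<^sub>0 assms(2) by (simp add: card_Diff_singleton card_Pow of_nat_diff)
    ultimately have "real n \<le> real (k \<pi>\<^sub>0) + (t - 1) * (real n * p)" by simp
    then show False using less[OF \<pi>\<^sub>0] by (simp add: algebra_simps)
  qed
  then obtain \<pi>\<^sub>1 where \<pi>\<^sub>1: "\<pi>\<^sub>1 \<subseteq> \<tau>" "\<pi>\<^sub>1 \<noteq> \<pi>\<^sub>0" "real n * p < real (k \<pi>\<^sub>1)" by blast
  have "0 \<le> real n * p" using assms(6) by simp
  then have "k \<pi>\<^sub>1 > 0" using \<pi>\<^sub>1(3) by linarith
  \<comment> \<open>The lower bound needs one point more than it counts: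
    \<open>n * p < j + 1\<close> yields the loss of 3. By maximality the type
    \<open>\<pi>\<^sub>0\<close> has at least \<open>Suc j\<close> points as well.\<close>
  then obtain j where j: "k \<pi>\<^sub>1 = Suc j" using gr0_implies_Suc by blast
  have "3 * j \<le> fo_size \<psi>"
    by (rule fo_size_ge_if_describes[OF \<psi>(1) assms(5) \<pi>\<^sub>1(1) \<pi>\<^sub>0 \<pi>\<^sub>1(2)])
      (use j max[OF \<pi>\<^sub>1(1)] in \<open>simp_all add: k_def\<close>)
  then have "real (3 * j) \<le> real (descr_complexity \<tau> n M)"
    unfolding \<psi>(2) by (simp only: of_nat_le_iff)
  moreover have "real n * p < real j + 1" using \<pi>\<^sub>1(3) j by simp
  ultimately have "3 * real n * p - 3 < real (descr_complexity \<tau> n M)" by simp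
  then show ?thesis using upper by blast
qed

end
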